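(* Let $\ell\in\mathbb{R}^2$ and $x_0\in\mathbb{R}^2$ with $x_0\ne\ell$. Consider the bearing-only system $\dot{x}=u$, $y=h(x)=\frac{\ell-x}{\|\ell-x\|}$ in $\mathbb{R}^2$, and let $r_0=\|\ell-x_0\|$ and $\psi_0$ be the angle with $x_0-\ell=r_0(\cos\psi_0,\sin\psi_0)$. For $s\ge 0$, define the input trajectories $$u_{cst}(s,\sigma)=\sigma(\ell-x_0),$$ $$u_{circ}(s,\omega,r_0)=\omega r_0\begin{bmatrix}-\sin(\omega s+\psi_0)\\ \cos(\omega s+\psi_0)\end{bmatrix},$$ $$u_{spi}(s,\omega,\alpha,r_0)=r_0\exp(\alpha s)\left(\omega\begin{bmatrix}-\sin(\omega s+\psi_0)\\ \cos(\omega s+\psi_0)\end{bmatrix}+\alpha\begin{bmatrix}\cos(\omega s+\psi_0)\\ \sin(\omega s+\psi_0)\end{bmatrix}\right).$$ Then: - For any $\sigma\in\mathbb{R}$, $u_{cst}(\cdot,\sigma)$ is neither a universal input trajectory of the system nor a weakly persistent input trajectory at $x_0$. - For any $\omega>0$ and $r_0>0$, $u_{circ}(\cdot,\omega,r_0)$ is a weakly regularly persistent input trajectory of the system at $x_0$. - For any $\omega>0$, $\alpha>0$ and $r_0>0$, $u_{spi}(\cdot,\omega,\alpha,r_0)$ is a weakly persistent input trajectory of the system at $x_0$, and for any $T>0$, $\lim_{t\to+\infty}\|\mathcal{C}(t,T,x(t-T),u_{spi})\|=0$.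
   Context: $\|\cdot\|$ is the Euclidean norm (operator norm for matrices) and $\overline{B}(a,R)$ the closed ball. The flow is $\phi(s_2;s_1,\xi,u)=\xi+\int_{s_1}^{s_2}u(s)\,\mathrm{d}s$, and $x(t)=\phi(t;0,x_0,u)$ is the reference trajectory for the input $u$ considered. The output map $h$ is given by its formula for $x\neq\ell$. Cumulative output error: $l(t_1,t_2,\xi_1,\xi_2,u)=\int_{t_1}^{t_2}\|h(\phi(s;t_1,\xi_1,u))-h(\phi(s;t_1,\xi_2,u))\|^2\,\mathrm{d}s$ for $0\le t_1\le t_2$. A $\mathcal{K}$-function is a continuous strictly increasing $\kappa:[0,\infty)\to\mathbb{R}$ with $\kappa(0)=0$. $u$ is a universal input trajectory if there exists $t\ge 0$ such that for any $\xi_1\ne\xi_2$ there exists $s\in[0,t]$ with $h(\phi(s;0,\xi_1,u))\ne h(\phi(s;0,\xi_2,u))$. $u$ is weakly persistent at $x_0$ if there exists $T>0$ such that for any $t\ge T$ there exist $R_t>0$ and a $\mathcal{K}$-function $\kappa_t$ such that for any $\xi_1,\xi_2\in\overline{B}(x(t-T),R_t)$: $l(t-T,t,\xi_1,\xi_2,u)\ge\kappa_t(\|\xi_1-\xi_2\|)$. It is weakly regularly persistent at $x_0$ if there exist $T>0$, $R>0$ and a $\mathcal{K}$-function $\kappa$ such that for any $t\ge T$ and any $\xi_1,\xi_2\in\overline{B}(x(t-T),R)$: $l(t-T,t,\xi_1,\xi_2,u)\ge\kappa(\|\xi_1-\xi_2\|)$. Observability Grammian of this system: with $e(s)=(e_1(s),e_2(s))=x(s)-\ell$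 and $r(s)=\|\ell-x(s)\|$, $$\mathcal{C}(t,T,x(t-T),u)=\int_{t-T}^{t}\frac{1}{r(s)^4}\begin{bmatrix}e_2(s)^2&-e_1(s)e_2(s)\\-e_1(s)e_2(s)&e_1(s)^2\end{bmatrix}\mathrm{d}s.$$ *)

theory Defs
  imports "HOL-Analysis.Analysis"
begin

text \<open>Systems with dynamics \<open>x' = u\<close> and output \<open>y = h x\<close>. The flow is only used for
  \<open>s1 \<le> s2\<close>; for \<open>s2 < s1\<close> the integral below is over the empty set.\<close>

definition flow :: "real \<Rightarrow> real \<Rightarrow> 'a::euclidean_space \<Rightarrow> (real \<Rightarrow> 'a) \<Rightarrow> 'a" where
  "flow s2 s1 \<xi> u = \<xi> + integral {s1..s2} u"

definition output_error ::
  "('a::euclidean_space \<Rightarrow> 'b::real_normed_vector) \<Rightarrow> real \<Rightarrow> real \<Rightarrow> 'a \<Rightarrow> 'a \<Rightarrow> (real \<Rightarrow> 'a) \<Rightarrow> real" where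
  "output_error h t1 t2 \<xi>1 \<xi>2 u =
     integral {t1..t2} (\<lambda>s. (norm (h (flow s t1 \<xi>1 u) - h (flow s t1 \<xi>2 u)))\<^sup>2)"

definition K_function :: "(real \<Rightarrow> real) \<Rightarrow> bool" where
  "K_function \<kappa> \<longleftrightarrow> continuous_on {0..} \<kappa> \<and> strict_mono_on {0..} \<kappa> \<and> \<kappa> 0 = 0"

definition universal_input ::
  "('a::euclidean_space \<Rightarrow> 'b::real_normed_vector) \<Rightarrow> (real \<Rightarrow> 'a) \<Rightarrow> bool" where
  "universal_input h u \<longleftrightarrow>
     (\<exists>t\<ge>0. \<forall>\<xi>1 \<xi>2. \<xi>1 \<noteq> \<xi>2 \<longrightarrow> (\<exists>s\<in>{0..t}. h (flow s 0 \<xi>1 u) \<noteq> h (flow s 0 \<xi>2 u)))"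

definition weakly_persistent ::
  "('a::euclidean_space \<Rightarrow> 'b::real_normed_vector) \<Rightarrow> (real \<Rightarrow> 'a) \<Rightarrow> 'a \<Rightarrow> bool" where
  "weakly_persistent h u x0 \<longleftrightarrow>
     (\<exists>T>0. \<forall>t\<ge>T. \<exists>R>0. \<exists>\<kappa>. K_function \<kappa> \<and>
        (\<forall>\<xi>1 \<in> cball (flow (t - T) 0 x0 u) R. \<forall>\<xi>2 \<in> cball (flow (t - T) 0 x0 u) R.
           output_error h (t - T) t \<xi>1 \<xi>2 u \<ge> \<kappa> (norm (\<xi>1 - \<xi>2))))"

definition weakly_regularly_persistent ::
  "('a::euclidean_space \<Rightarrow> 'b::real_normed_vector) \<Rightarrow> (real \<Rightarrow> 'a) \<Rightarrow> 'a \<Rightarrow> bool" where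
  "weakly_regularly_persistent h u x0 \<longleftrightarrow>
     (\<exists>T>0. \<exists>R>0. \<exists>\<kappa>. K_function \<kappa> \<and>
        (\<forall>t\<ge>T. \<forall>\<xi>1 \<in> cball (flow (t - T) 0 x0 u) R. \<forall>\<xi>2 \<in> cball (flow (t - T) 0 x0 u) R.
           output_error h (t - T) t \<xi>1 \<xi>2 u \<ge> \<kappa> (norm (\<xi>1 - \<xi>2))))"

text \<open>The formula \<open>h x = (l - x) / \<parallel>l - x\<parallel>\<close> is meaningful only for \<open>x \<noteq> l\<close>;
  the value of \<open>h\<close> at the landmark \<open>l\<close> is left unconstrained.\<close>

definition bearing_output :: "real^2 \<Rightarrow> (real^2 \<Rightarrow> real^2) \<Rightarrow> bool" where
  "bearing_output l h \<longleftrightarrow> (\<forall>x. x \<noteq> l \<longrightarrow> h x = (l - x) /\<^sub>R norm (l - x))"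

text \<open>Observability Grammian of the bearing-only system on \<open>[t - T, t]\<close> along the reference
  trajectory \<open>x s = flow s 0 x0 u\<close>; the initial state \<open>x (t - T)\<close> of that time window
  is determined by \<open>x0\<close> and \<open>u\<close>.\<close>

definition bearing_grammian :: "real^2 \<Rightarrow> real^2 \<Rightarrow> real \<Rightarrow> real \<Rightarrow> (real \<Rightarrow> real^2) \<Rightarrow> real^2^2" where
  "bearing_grammian l x0 t T u =
     integral {t - T..t} (\<lambda>s.
       let x = flow s 0 x0 u; e = x - l; r = norm (l - x)
       in (1 / r^4) *\<^sub>R vector [vector [(e$2)\<^sup>2, - (e$1) * e$2],
                               vector [- (e$1) * e$2, (e$1)\<^sup>2]])"

definition u_cst :: "real^2 \<Rightarrow> real^2 \<Rightarrow> real \<Rightarrow> real \<Rightarrow> real^2" where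
  "u_cst l x0 \<sigma> s = \<sigma> *\<^sub>R (l - x0)"

definition u_circ :: "real \<Rightarrow> real \<Rightarrow> real \<Rightarrow> real \<Rightarrow> real^2" where
  "u_circ \<psi>0 \<omega> r0 s = (\<omega> * r0) *\<^sub>R vector [- sin (\<omega> * s + \<psi>0), cos (\<omega> * s + \<psi>0)]"

definition u_spi :: "real \<Rightarrow> real \<Rightarrow> real \<Rightarrow> real \<Rightarrow> real \<Rightarrow> real^2" where
  "u_spi \<psi>0 \<omega> \<alpha> r0 s =
     (r0 * exp (\<alpha> * s)) *\<^sub>R
       (\<omega> *\<^sub>R vector [- sin (\<omega> * s + \<psi>0), cos (\<omega> * s + \<psi>0)]
        + \<alpha> *\<^sub>R vector [cos (\<omega> * s + \<psi>0), sin (\<omega> * s + \<psi>0)])"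

end

(* In polar coordinates around l the second and third inputs produce the spiral
   r0 exp (alpha s) (cos (omega s + psi0), sin (omega s + psi0)), a circle if alpha = 0. The
   distance of the bearings of v and w is at least |v x w| / (|v| |w|), and v x w = v x (w - v).
   Over one period of the angle, the integral of the squared cross product of the unit direction
   with d is T |d|^2 / 2, so that for initial states at distance at most r0 / 4 from the reference
   the output error dominates c |xi1 - xi2|^2, where c depends only on the largest distance to l.
   The first input moves radially: points on a ray from l keep their common bearing while they do
   not meet l. The Grammian decays because its integrand is of size 1 / r(s)^2. *)

theory Submission
  imports Defs "HOL-Real_Asymp.Real_Asymp"
begin

section \<open>Planar cross product and the gap between two bearings\<close>

definition cross2 :: "real^2 \<Rightarrow> real^2 \<Rightarrow> real" where
  "cross2 v w = v$1 * w$2 - v$2 * w$1"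

definition dir2 :: "real \<Rightarrow> real^2" where
  "dir2 \<theta> = vector [cos \<theta>, sin \<theta>]"

text \<open>A primitive of \<open>u_spi \<psi> \<omega> \<alpha> r\<close>, with the landmark as
  origin: flows become differences of its values.\<close>

definition spiral :: "real \<Rightarrow> real \<Rightarrow> real \<Rightarrow> real \<Rightarrow> real \<Rightarrow> real^2" where
  "spiral \<psi> \<omega> \<alpha> r s = (r * exp (\<alpha> * s)) *\<^sub>R dir2 (\<omega> * s + \<psi>)"

text \<open>Constant basis vectors with scalar coefficients are the form on which the
  differentiation rules act.\<close>

lemma vector_2_axis: "(vector [a, b] :: real^2) = a *\<^sub>R axis 1 1 + b *\<^sub>R axis 2 1"
  by (simp add: vec_eq_iff forall_2 axis_def)

lemma norm_power2_2: "(norm (v :: real^2))\<^sup>2 = (v$1)\<^sup>2 + (v$2)\<^sup>2"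
  unfolding power2_norm_eq_inner inner_vec_def sum_2 by (simp add: power2_eq_square)

lemma norm_dir2 [simp]: "norm (dir2 \<theta>) = 1"
  by (rule power2_eq_imp_eq) (simp_all add: norm_power2_2 dir2_def)

text \<open>Lagrange's identity in the plane: the squares of the sine and cosine of the angle
  between \<open>v\<close> and \<open>w\<close> add up to 1.\<close>

lemma cross2_inner_power2: "(cross2 v w)\<^sup>2 + (v \<bullet> w)\<^sup>2 = (norm v)\<^sup>2 * (norm w)\<^sup>2"
  unfolding norm_power2_2 cross2_def inner_vec_def sum_2
  by (simp add: power2_eq_square algebra_simps)

lemma cross2_power2_le: "(cross2 v w)\<^sup>2 \<le> (norm v)\<^sup>2 * (norm w)\<^sup>2"
  using cross2_inner_power2[of v w] by (smt (verit) zero_le_power2)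

lemma cross2_add_left: "cross2 (v + w) d = cross2 v d + cross2 w d"
  by (simp add: cross2_def algebra_simps)

lemma cross2_scaleR_left: "cross2 (c *\<^sub>R v) d = c * cross2 v d"
  by (simp add: cross2_def algebra_simps)

text \<open>Brings in \<open>w - v\<close>, which stays constant when two states are driven by the
  same input.\<close>

lemma cross2_diff_self: "cross2 v (w - v) = cross2 v w"
  by (simp add: cross2_def algebra_simps)

text \<open>For unit vectors with inner product \<open>c\<close> the claim is \<open>2 - 2 * c \<ge> 1 - c\<^sup>2\<close>.\<close>

lemma bearing_diff_ge:
  fixes v w :: "real^2"
  assumes "v \<noteq> 0" "w \<noteq> 0"
  shows "(cross2 v w)\<^sup>2 / ((norm v)\<^sup>2 * (norm w)\<^sup>2) \<le> (norm (v /\<^sub>R norm v - w /\<^sub>R norm w))\<^sup>2"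
proof -
  define c where "c = (v /\<^sub>R norm v) \<bullet> (w /\<^sub>R norm w)"
  have c: "c = (v \<bullet> w) / (norm v * norm w)"
    by (simp add: c_def field_simps)
  have 1: "(norm (v /\<^sub>R norm v))\<^sup>2 = 1" "(norm (w /\<^sub>R norm w))\<^sup>2 = 1"
    using assms by auto
  have "(norm (v /\<^sub>R norm v - w /\<^sub>R norm w))\<^sup>2 = 2 - 2 * c"
    using 1 unfolding power2_norm_eq_inner c_def
    by (simp add: inner_diff_left inner_diff_right inner_commute)
  moreover have "(cross2 v w)\<^sup>2 / ((norm v)\<^sup>2 * (norm w)\<^sup>2) = 1 - c\<^sup>2"
    using cross2_inner_power2[of v w] assms
    by (simp add: c power_divide power_mult_distrib field_simps)
  moreover have "2 - 2 * c - (1 - c\<^sup>2) = (1 - c)\<^sup>2"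
    by (simp add: power2_eq_square algebra_simps)
  ultimately show ?thesis
    by (smt (verit) zero_le_power2)
qed

section \<open>Trajectories of the three inputs\<close>

lemma norm_spiral: "r \<ge> 0 \<Longrightarrow> norm (spiral \<psi> \<omega> \<alpha> r s) = r * exp (\<alpha> * s)"
  by (simp add: spiral_def)

lemma spiral_has_vector_derivative:
  "(spiral \<psi> \<omega> \<alpha> r has_vector_derivative u_spi \<psi> \<omega> \<alpha> r s) (at s within S)"
  unfolding spiral_def[abs_def] u_spi_def dir2_def vector_2_axis
  by (auto intro!: derivative_eq_intros simp: algebra_simps has_real_derivative_iff_has_vector_derivative[symmetric])

lemma continuous_on_spiral: "continuous_on S (spiral \<psi> \<omega> \<alpha> r)"
  by (rule continuous_on_vector_derivative) (rule spiral_has_vector_derivative)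

lemma flow_eq_diff:
  assumes "t1 \<le> s" and "\<And>s. (p has_vector_derivative u s) (at s)"
  shows "flow s t1 \<xi> u = \<xi> + (p s - p t1)"
  using fundamental_theorem_of_calculus[OF assms(1), of p u] assms(2)
  by (simp add: flow_def has_vector_derivative_at_within integral_unique)

lemma flow_spiral:
  "t1 \<le> s \<Longrightarrow> flow s t1 \<xi> (u_spi \<psi> \<omega> \<alpha> r) = \<xi> + (spiral \<psi> \<omega> \<alpha> r s - spiral \<psi> \<omega> \<alpha> r t1)"
  by (rule flow_eq_diff) (auto intro: spiral_has_vector_derivative)

lemma flow_u_cst: "t1 \<le> s \<Longrightarrow> flow s t1 \<xi> (u_cst l x0 \<sigma>) = \<xi> + (\<sigma> * (s - t1)) *\<^sub>R (l - x0)"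
  by (simp add: flow_def u_cst_def[abs_def] mult.commute)

lemma u_circ_eq_u_spi: "u_circ \<psi> \<omega> r = u_spi \<psi> \<omega> 0 r"
  by (auto simp: u_circ_def u_spi_def mult.commute)

section \<open>Lower bound for the output error over one period\<close>

lemma bearing_output_add:
  assumes "bearing_output l h" "v \<noteq> 0"
  shows "h (l + v) = - (v /\<^sub>R norm v)"
  using assms by (auto simp: bearing_output_def)

text \<open>The integrand is its mean \<open>(norm d)\<^sup>2 / 2\<close> plus terms in the doubled
  angle, which integrate to 0 over a full period.\<close>

lemma has_integral_cross2_dir2_period:
  fixes d :: "real^2"
  assumes "\<omega> > 0" and T: "T = 2 * pi / \<omega>"
  shows "((\<lambda>s. (cross2 (dir2 (\<omega> * s + \<psi>)) d)\<^sup>2) has_integral (T * (norm d)\<^sup>2 / 2)) {t - T..t}"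
proof -
  define S where "S s = sin (\<omega> * s + \<psi>)" for s
  define C where "C s = cos (\<omega> * s + \<psi>)" for s
  \<comment> \<open>An antiderivative: up to the factor \<open>\<omega>\<close>, the derivative of
    \<open>S s * C s\<close> is the cosine of the doubled angle, and that of
    \<open>(C s)\<^sup>2\<close> is minus its sine.\<close>
  define F where "F s = (norm d)\<^sup>2 / 2 * s + ((d$2)\<^sup>2 - (d$1)\<^sup>2) / (2 * \<omega>) * (S s * C s)
    + d$1 * d$2 / \<omega> * (C s)\<^sup>2" for s
  have deriv: "(F has_real_derivative (cross2 (dir2 (\<omega> * s + \<psi>)) d)\<^sup>2) (at s within A)" for s A
  proof -
    have [derivative_intros]: "(S has_real_derivative \<omega> * C s) (at s within A)"
      "(C has_real_derivative - \<omega> * S s) (at s within A)"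
      unfolding S_def[abs_def] C_def[abs_def] by (auto intro!: derivative_eq_intros)
    have SC: "((\<lambda>s. S s * C s) has_real_derivative \<omega> * ((C s)\<^sup>2 - (S s)\<^sup>2)) (at s within A)"
      by (auto intro!: derivative_eq_intros simp: power2_eq_square algebra_simps)
    have CC: "((\<lambda>s. (C s)\<^sup>2) has_real_derivative - 2 * \<omega> * C s * S s) (at s within A)"
      by (auto intro!: derivative_eq_intros)
    have "(F has_real_derivative (norm d)\<^sup>2 / 2 * 1
        + ((d$2)\<^sup>2 - (d$1)\<^sup>2) / (2 * \<omega>) * (\<omega> * ((C s)\<^sup>2 - (S s)\<^sup>2))
        + d$1 * d$2 / \<omega> * (- 2 * \<omega> * C s * S s)) (at s within A)"
      unfolding F_def[abs_def] by (intro DERIV_add DERIV_cmult SC CC DERIV_ident)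
    \<comment> \<open>The inserted factor \<open>(S s)\<^sup>2 + (C s)\<^sup>2\<close> is 1; it
      turns the remaining claim into a polynomial identity.\<close>
    moreover have "(norm d)\<^sup>2 / 2 * 1 = ((d$1)\<^sup>2 + (d$2)\<^sup>2) * ((S s)\<^sup>2 + (C s)\<^sup>2) / 2"
      by (simp add: norm_power2_2 S_def C_def)
    moreover have "((d$2)\<^sup>2 - (d$1)\<^sup>2) / (2 * \<omega>) * (\<omega> * ((C s)\<^sup>2 - (S s)\<^sup>2))
        = ((d$2)\<^sup>2 - (d$1)\<^sup>2) * ((C s)\<^sup>2 - (S s)\<^sup>2) / 2"
      "d$1 * d$2 / \<omega> * (- 2 * \<omega> * C s * S s) = - 2 * (d$1 * d$2 * C s * S s)"
      using assms(1) by simp_all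
    moreover have "((d$1)\<^sup>2 + (d$2)\<^sup>2) * ((S s)\<^sup>2 + (C s)\<^sup>2) / 2
        + ((d$2)\<^sup>2 - (d$1)\<^sup>2) * ((C s)\<^sup>2 - (S s)\<^sup>2) / 2 + - 2 * (d$1 * d$2 * C s * S s)
        = (C s * d$2 - S s * d$1)\<^sup>2"
      by (simp add: power2_eq_square field_simps)
    ultimately have "(F has_real_derivative (C s * d$2 - S s * d$1)\<^sup>2) (at s within A)"
      by (simp only:)
    then show ?thesis
      by (simp add: cross2_def dir2_def S_def C_def)
  qed
  have "T > 0" using assms by simp
  \<comment> \<open>The trigonometric terms of \<open>F\<close> agree at both ends of the window, so
    only the linear term contributes.\<close>
  have "\<omega> * t + \<psi> = \<omega> * (t - T) + \<psi> + 2 * pi"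
    using assms by (simp add: field_simps)
  then have "S t = S (t - T)" "C t = C (t - T)"
    unfolding S_def C_def by (simp_all only: sin_periodic cos_periodic)
  then have "F t - F (t - T) = T * (norm d)\<^sup>2 / 2"
    by (simp add: F_def right_diff_distrib)
  moreover have "((\<lambda>s. (cross2 (dir2 (\<omega> * s + \<psi>)) d)\<^sup>2) has_integral (F t - F (t - T))) {t - T..t}"
    using deriv \<open>T > 0\<close>
    by (intro fundamental_theorem_of_calculus) (auto simp flip: has_real_derivative_iff_has_vector_derivative)
  ultimately show ?thesis by (simp only:)
qed

text \<open>The cross product of the two states seen from \<open>l\<close> is a reference term,
  large in mean square over a period, plus a term from the initial offset, small because of the
  radius \<open>r / 4\<close>. The bound depends on \<open>t\<close> only through
  \<open>exp (\<alpha> * t)\<close>, hence not at all for \<open>\<alpha> = 0\<close>.\<close>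

lemma output_error_spiral_ge:
  fixes l x0 :: "real^2"
  assumes h: "bearing_output l h" and r: "r > 0" and x0: "x0 - l = spiral \<psi> \<omega> \<alpha> r 0"
    and \<omega>: "\<omega> > 0" and \<alpha>: "\<alpha> \<ge> 0" and T: "T = 2 * pi / \<omega>" and t: "t \<ge> T"
    and \<xi>1: "\<xi>1 \<in> cball (flow (t - T) 0 x0 (u_spi \<psi> \<omega> \<alpha> r)) (r / 4)"
    and \<xi>2: "\<xi>2 \<in> cball (flow (t - T) 0 x0 (u_spi \<psi> \<omega> \<alpha> r)) (r / 4)"
  shows "3 / 16 * r\<^sup>2 * T / (r * exp (\<alpha> * t) + r) ^ 4 * (norm (\<xi>1 - \<xi>2))\<^sup>2
    \<le> output_error h (t - T) t \<xi>1 \<xi>2 (u_spi \<psi> \<omega> \<alpha> r)"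
proof -
  \<comment> \<open>\<open>p\<close> is the reference trajectory seen from \<open>l\<close>; the
    offsets \<open>\<delta>1\<close> and \<open>\<delta>2\<close> of the two states from it are
    preserved by the flow.\<close>
  define p where "p = spiral \<psi> \<omega> \<alpha> r"
  define \<delta>1 where "\<delta>1 = \<xi>1 - l - p (t - T)"
  define \<delta>2 where "\<delta>2 = \<xi>2 - l - p (t - T)"
  define d where "d = \<xi>2 - \<xi>1"
  define M where "M = r * exp (\<alpha> * t) + r"
  have T0: "T > 0" using T \<omega> by simp
  have M: "M > 0" using r by (simp add: M_def add_pos_pos)
  have "x0 = l + p 0" using x0 by (simp add: p_def algebra_simps)
  then have c: "flow (t - T) 0 x0 (u_spi \<psi> \<omega> \<alpha> r) = l + p (t - T)"
    using flow_spiral[of 0 "t - T"] t by (simp add: p_def)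
  have \<delta>: "norm \<delta>1 \<le> r / 4" "norm \<delta>2 \<le> r / 4"
    using \<xi>1 \<xi>2 unfolding c \<delta>1_def \<delta>2_def
    by (simp_all add: dist_norm norm_minus_commute algebra_simps)
  have fl: "flow s (t - T) \<xi>1 (u_spi \<psi> \<omega> \<alpha> r) = l + (p s + \<delta>1)"
    "flow s (t - T) \<xi>2 (u_spi \<psi> \<omega> \<alpha> r) = l + (p s + \<delta>2)" if "s \<in> {t - T..t}" for s
    using that flow_spiral[of "t - T" s] by (simp_all add: \<delta>1_def \<delta>2_def p_def)
  \<comment> \<open>The reference stays at distance at least \<open>r\<close> from \<open>l\<close>,
    so an offset of at most \<open>r / 4\<close> cannot reach the landmark, where \<open>h\<close>
    is unconstrained.\<close>
  have bd: "norm (p s + \<delta>) \<le> M \<and> p s + \<delta> \<noteq> 0"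
    if "s \<in> {t - T..t}" "norm \<delta> \<le> r / 4" for s \<delta>
  proof -
    have "0 \<le> s" "s \<le> t" using that t by auto
    then have "1 \<le> exp (\<alpha> * s)" "exp (\<alpha> * s) \<le> exp (\<alpha> * t)"
      using \<alpha> by (simp_all add: mult_left_mono)
    then have "r \<le> norm (p s)" "norm (p s) \<le> r * exp (\<alpha> * t)"
      using r by (simp_all add: p_def norm_spiral)
    moreover have "norm (p s) - norm \<delta> \<le> norm (p s + \<delta>)"
      using norm_diff_ineq by blast
    moreover have "norm (p s + \<delta>) \<le> norm (p s) + norm \<delta>"
      by (rule norm_triangle_ineq)
    ultimately have "norm (p s + \<delta>) \<le> M" "norm (p s + \<delta>) > 0"
      unfolding M_def using r that(2) by linarith+
    then show ?thesis by auto
  qed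
  define f where "f s = (norm ((p s + \<delta>1) /\<^sub>R norm (p s + \<delta>1) - (p s + \<delta>2) /\<^sub>R norm (p s + \<delta>2)))\<^sup>2" for s
  define g where "g s = (r\<^sup>2 / 2 * (cross2 (dir2 (\<omega> * s + \<psi>)) d)\<^sup>2 - (r / 4)\<^sup>2 * (norm d)\<^sup>2) / M ^ 4" for s
  have err: "output_error h (t - T) t \<xi>1 \<xi>2 (u_spi \<psi> \<omega> \<alpha> r) = integral {t - T..t} f"
    unfolding output_error_def
  proof (rule integral_cong)
    fix s assume s: "s \<in> {t - T..t}"
    show "(norm (h (flow s (t - T) \<xi>1 (u_spi \<psi> \<omega> \<alpha> r)) - h (flow s (t - T) \<xi>2 (u_spi \<psi> \<omega> \<alpha> r))))\<^sup>2 = f s"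
      using bd[OF s \<delta>(1)] bd[OF s \<delta>(2)]
      by (simp add: fl[OF s] bearing_output_add[OF h] f_def norm_minus_commute)
  qed
  have "continuous_on {t - T..t} f"
    unfolding f_def[abs_def] p_def using bd \<delta>
    by (intro continuous_intros continuous_on_spiral) (auto simp: p_def)
  then have int_f: "(f has_integral output_error h (t - T) t \<xi>1 \<xi>2 (u_spi \<psi> \<omega> \<alpha> r)) {t - T..t}"
    unfolding err by (simp add: integrable_continuous_interval integrable_integral)
  \<comment> \<open>The constant arises as 1/4 - 1/16 = 3/16: half of the mean square 1/2, minus the
    square of the relative radius 1/4.\<close>
  have int_g: "(g has_integral (3 / 16 * r\<^sup>2 * T / M ^ 4 * (norm d)\<^sup>2)) {t - T..t}"
  proof -
    have "((\<lambda>s. (r\<^sup>2 / 2 * (cross2 (dir2 (\<omega> * s + \<psi>)) d)\<^sup>2 - (r / 4)\<^sup>2 * (norm d)\<^sup>2) / M ^ 4) has_integral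
       (r\<^sup>2 / 2 * (T * (norm d)\<^sup>2 / 2) - T * ((r / 4)\<^sup>2 * (norm d)\<^sup>2)) / M ^ 4) {t - T..t}"
      using T0 has_integral_const_real[of "(r / 4)\<^sup>2 * (norm d)\<^sup>2" "t - T" t]
      by (intro has_integral_divide has_integral_diff has_integral_mult_right
            has_integral_cross2_dir2_period \<omega> T) simp
    then show ?thesis
      unfolding g_def[abs_def] by (simp add: field_simps power2_eq_square)
  qed
  have "g s \<le> f s" if s: "s \<in> {t - T..t}" for s
  proof -
    let ?v = "p s + \<delta>1" and ?w = "p s + \<delta>2"
    define a where "a = cross2 (p s) d"
    define b where "b = cross2 \<delta>1 d"
    have s0: "0 \<le> s" using s t by simp
    have v: "?v \<noteq> 0" "norm ?v \<le> M" and w: "?w \<noteq> 0" "norm ?w \<le> M"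
      using bd[OF s] \<delta> by auto
    have d: "d = ?w - ?v" by (simp add: d_def \<delta>1_def \<delta>2_def)
    have "r\<^sup>2 * (cross2 (dir2 (\<omega> * s + \<psi>)) d)\<^sup>2 \<le> a\<^sup>2"
      unfolding a_def p_def spiral_def cross2_scaleR_left power_mult_distrib
      using r \<alpha> s0 by (intro mult_right_mono) (auto simp: one_le_power)
    moreover have "b\<^sup>2 \<le> (r / 4)\<^sup>2 * (norm d)\<^sup>2"
      unfolding b_def using \<delta>(1)
      by (intro order_trans[OF cross2_power2_le] mult_right_mono power_mono) auto
    \<comment> \<open>The mixed term \<open>2 * a * b\<close> has no fixed sign; it is absorbed at
      the cost of \<open>a\<^sup>2 / 2 + 2 * b\<^sup>2\<close>.\<close>
    moreover have "a\<^sup>2 / 2 - b\<^sup>2 \<le> (a + b)\<^sup>2"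
    proof -
      have "(a + b)\<^sup>2 - (a\<^sup>2 / 2 - b\<^sup>2) = (a + 2 * b)\<^sup>2 / 2"
        by (simp add: power2_eq_square field_simps)
      then show ?thesis by (smt (verit) zero_le_power2 divide_nonneg_pos)
    qed
    \<comment> \<open>Replacing \<open>?w\<close> by \<open>?w - ?v = d\<close> makes the expression
      linear in the constant separation \<open>d\<close>.\<close>
    moreover have "a + b = cross2 ?v ?w"
      using cross2_diff_self[of ?v ?w] unfolding d[symmetric] by (simp add: a_def b_def cross2_add_left)
    ultimately have "r\<^sup>2 / 2 * (cross2 (dir2 (\<omega> * s + \<psi>)) d)\<^sup>2 - (r / 4)\<^sup>2 * (norm d)\<^sup>2 \<le> (cross2 ?v ?w)\<^sup>2"
      by simp
    then have "g s \<le> (cross2 ?v ?w)\<^sup>2 / M ^ 4"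
      unfolding g_def using M by (intro divide_right_mono) auto
    also have "\<dots> \<le> (cross2 ?v ?w)\<^sup>2 / ((norm ?v)\<^sup>2 * (norm ?w)\<^sup>2)"
    proof -
      have "(norm ?v)\<^sup>2 * (norm ?w)\<^sup>2 \<le> M\<^sup>2 * M\<^sup>2"
        using v w by (intro mult_mono power_mono) auto
      then show ?thesis
        using v w M by (intro divide_left_mono) (auto simp: power2_eq_square power4_eq_xxxx mult.assoc)
    qed
    also have "\<dots> \<le> f s"
      unfolding f_def by (rule bearing_diff_ge[OF v(1) w(1)])
    finally show ?thesis .
  qed
  then show ?thesis
    using has_integral_le[OF int_g int_f] by (simp add: M_def d_def norm_minus_commute)
qed

section \<open>Persistence of the spiral and of the circle\<close>

lemma K_function_quadratic: "c > 0 \<Longrightarrow> K_function (\<lambda>x. c * x\<^sup>2)"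
  unfolding K_function_def
  by (auto intro!: continuous_intros strict_mono_onI mult_strict_left_mono power_strict_mono)

text \<open>One period as window length and the radius \<open>r / 4\<close> serve for all
  \<open>t\<close>; only the K-function varies, its factor being of order
  \<open>exp (- 4 * \<alpha> * t)\<close>.\<close>

lemma weakly_persistent_u_spi:
  fixes l x0 :: "real^2"
  assumes "bearing_output l h" "r > 0" "x0 - l = spiral \<psi> \<omega> \<alpha> r 0" "\<omega> > 0" "\<alpha> \<ge> 0"
  shows "weakly_persistent h (u_spi \<psi> \<omega> \<alpha> r) x0"
proof -
  define T where "T = 2 * pi / \<omega>"
  have T: "T > 0" using assms by (simp add: T_def)
  define c where "c t = 3 / 16 * r\<^sup>2 * T / (r * exp (\<alpha> * t) + r) ^ 4" for t
  have "c t > 0" for t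
    using T assms(2) by (auto simp: c_def intro!: divide_pos_pos mult_pos_pos add_pos_pos zero_less_power)
  then have "K_function (\<lambda>x. c t * x\<^sup>2)" for t
    by (rule K_function_quadratic)
  moreover have "c t * (norm (\<xi>1 - \<xi>2))\<^sup>2 \<le> output_error h (t - T) t \<xi>1 \<xi>2 (u_spi \<psi> \<omega> \<alpha> r)"
    if "t \<ge> T" "\<xi>1 \<in> cball (flow (t - T) 0 x0 (u_spi \<psi> \<omega> \<alpha> r)) (r / 4)"
      "\<xi>2 \<in> cball (flow (t - T) 0 x0 (u_spi \<psi> \<omega> \<alpha> r)) (r / 4)" for t \<xi>1 \<xi>2
    unfolding c_def by (rule output_error_spiral_ge[OF assms T_def that])
  moreover have "r / 4 > 0"
    using assms(2) by simp
  ultimately show ?thesis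
    unfolding weakly_persistent_def using T by meson
qed

lemma weakly_regularly_persistent_u_circ:
  fixes l x0 :: "real^2"
  assumes "bearing_output l h" "r > 0" "x0 - l = spiral \<psi> \<omega> 0 r 0" "\<omega> > 0"
  shows "weakly_regularly_persistent h (u_circ \<psi> \<omega> r) x0"
proof -
  define T where "T = 2 * pi / \<omega>"
  have T: "T > 0" using assms by (simp add: T_def)
  define c where "c = 3 / 16 * r\<^sup>2 * T / (r + r) ^ 4"
  have "c > 0"
    using T assms(2) by (auto simp: c_def intro!: divide_pos_pos mult_pos_pos add_pos_pos zero_less_power)
  then have "K_function (\<lambda>x. c * x\<^sup>2)"
    by (rule K_function_quadratic)
  moreover have "c * (norm (\<xi>1 - \<xi>2))\<^sup>2 \<le> output_error h (t - T) t \<xi>1 \<xi>2 (u_circ \<psi> \<omega> r)"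
    if "t \<ge> T" "\<xi>1 \<in> cball (flow (t - T) 0 x0 (u_circ \<psi> \<omega> r)) (r / 4)"
      "\<xi>2 \<in> cball (flow (t - T) 0 x0 (u_circ \<psi> \<omega> r)) (r / 4)" for t \<xi>1 \<xi>2
    using output_error_spiral_ge[OF assms order_refl T_def that[unfolded u_circ_eq_u_spi]]
    by (simp add: c_def u_circ_eq_u_spi)
  moreover have "r / 4 > 0"
    using assms(2) by simp
  ultimately show ?thesis
    unfolding weakly_regularly_persistent_def using T by meson
qed

section \<open>Failure of the radial input\<close>

text \<open>The bearing depends only on the direction from \<open>l\<close>, and
  \<open>a * b > 0\<close> puts both points on the same open ray.\<close>

lemma bearing_collinear:
  assumes "bearing_output l h" "v \<noteq> 0" "a * b > 0"
  shows "h (l + a *\<^sub>R v) = h (l + b *\<^sub>R v)"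
proof -
  have h: "h (l + x) = - sgn x" if "x \<noteq> 0" for x
    using bearing_output_add[OF assms(1) that] by (simp add: sgn_div_norm)
  have "sgn a = sgn b" "a \<noteq> 0" "b \<noteq> 0"
    using assms(3) by (auto simp: zero_less_mult_iff)
  then show ?thesis
    using assms(2) by (simp add: h sgn_scaleR)
qed

text \<open>For any horizon, two points far enough out on the ray from \<open>l\<close> through
  \<open>x0\<close> do not reach \<open>l\<close> in time.\<close>

lemma not_universal_input_u_cst:
  fixes l x0 :: "real^2"
  assumes "bearing_output l h" "x0 \<noteq> l"
  shows "\<not> universal_input h (u_cst l x0 \<sigma>)"
proof
  assume "universal_input h (u_cst l x0 \<sigma>)"
  then obtain t where t: "t \<ge> 0" and
    distinct: "\<And>\<xi>1 \<xi>2. \<xi>1 \<noteq> \<xi>2 \<Longrightarrow>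
      \<exists>s\<in>{0..t}. h (flow s 0 \<xi>1 (u_cst l x0 \<sigma>)) \<noteq> h (flow s 0 \<xi>2 (u_cst l x0 \<sigma>))"
    unfolding universal_input_def by blast
  \<comment> \<open>Bounds the radial displacement during the horizon, in multiples of
    \<open>x0 - l\<close>; the coefficients \<open>c + 1\<close> and \<open>c + 2\<close> therefore
    stay positive.\<close>
  define c where "c = \<bar>\<sigma>\<bar> * t"
  have "l + (c + 1) *\<^sub>R (x0 - l) \<noteq> l + (c + 2) *\<^sub>R (x0 - l)"
    using assms(2) by simp
  from distinct[OF this] obtain s where s: "s \<in> {0..t}" and
    neq: "h (flow s 0 (l + (c + 1) *\<^sub>R (x0 - l)) (u_cst l x0 \<sigma>))
       \<noteq> h (flow s 0 (l + (c + 2) *\<^sub>R (x0 - l)) (u_cst l x0 \<sigma>))"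
    by blast
  have fl: "flow s 0 (l + k *\<^sub>R (x0 - l)) (u_cst l x0 \<sigma>) = l + (k - \<sigma> * s) *\<^sub>R (x0 - l)" for k
    using s by (simp add: flow_u_cst algebra_simps)
  have "\<sigma> * s \<le> c"
    unfolding c_def using s by (intro mult_mono) auto
  then have "(c + 1 - \<sigma> * s) * (c + 2 - \<sigma> * s) > 0"
    by (intro mult_pos_pos) auto
  then show False
    using neq bearing_collinear[OF assms(1), of "x0 - l"] assms(2) unfolding fl by auto
qed

text \<open>For \<open>\<sigma> > 0\<close> the reference trajectory runs through the landmark at time \<open>1 / \<sigma>\<close>, where the
  bearing jumps; the time window must therefore start after that, at \<open>2 / \<sigma>\<close>.\<close>

lemma not_weakly_persistent_u_cst:
  fixes l x0 :: "real^2"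
  assumes "bearing_output l h" "x0 \<noteq> l"
  shows "\<not> weakly_persistent h (u_cst l x0 \<sigma>) x0"
proof
  let ?u = "u_cst l x0 \<sigma>" and ?v = "x0 - l"
  assume "weakly_persistent h ?u x0"
  then obtain T where T: "T > 0" and wp: "\<And>t. t \<ge> T \<Longrightarrow> \<exists>R>0. \<exists>\<kappa>. K_function \<kappa> \<and>
        (\<forall>\<xi>1 \<in> cball (flow (t - T) 0 x0 ?u) R. \<forall>\<xi>2 \<in> cball (flow (t - T) 0 x0 ?u) R.
           output_error h (t - T) t \<xi>1 \<xi>2 ?u \<ge> \<kappa> (norm (\<xi>1 - \<xi>2)))"
    unfolding weakly_persistent_def by blast
  define \<tau> where "\<tau> = (if \<sigma> > 0 then 2 / \<sigma> else 0)"
  \<comment> \<open>The reference position at the start of the window: the mirror image of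
    \<open>x0\<close> in \<open>l\<close> after the passage, or \<open>x0\<close> itself if
    \<open>\<sigma> \<le> 0\<close>.\<close>
  define c :: real where "c = (if \<sigma> > 0 then -1 else 1)"
  have \<tau>: "\<tau> \<ge> 0" by (simp add: \<tau>_def)
  have ref: "flow \<tau> 0 x0 ?u = l + c *\<^sub>R ?v"
  proof -
    have "flow \<tau> 0 x0 ?u = l + (1 - \<sigma> * \<tau>) *\<^sub>R ?v"
      using \<tau> by (simp add: flow_u_cst algebra_simps)
    also have "1 - \<sigma> * \<tau> = c"
      by (simp add: \<tau>_def c_def)
    finally show ?thesis .
  qed
  obtain R \<kappa> where R: "R > 0" and \<kappa>: "K_function \<kappa>" and
    ge: "\<And>\<xi>1 \<xi>2. \<xi>1 \<in> cball (l + c *\<^sub>R ?v) R \<Longrightarrow> \<xi>2 \<in> cball (l + c *\<^sub>R ?v) R \<Longrightarrow>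
      output_error h \<tau> (\<tau> + T) \<xi>1 \<xi>2 ?u \<ge> \<kappa> (norm (\<xi>1 - \<xi>2))"
    using wp[of "\<tau> + T"] \<tau> by (auto simp: ref)
  \<comment> \<open>The bound \<open>1 / 2\<close> keeps \<open>c + \<epsilon>\<close> on the same
    side of 0 as \<open>c\<close>; the other bound keeps the second state in the ball.\<close>
  define \<epsilon> where "\<epsilon> = min (1 / 2) (R / norm ?v)"
  have \<epsilon>: "\<epsilon> > 0" "\<epsilon> \<le> 1 / 2" "\<epsilon> * norm ?v \<le> R"
    using R assms(2) by (auto simp: \<epsilon>_def min_def field_simps)
  let ?\<xi>1 = "l + c *\<^sub>R ?v" and ?\<xi>2 = "l + (c + \<epsilon>) *\<^sub>R ?v"
  have diff: "norm (?\<xi>1 - ?\<xi>2) = \<epsilon> * norm ?v"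
    using \<epsilon>(1) by (simp add: algebra_simps flip: scaleR_diff_right)
  have "h (flow s \<tau> ?\<xi>1 ?u) = h (flow s \<tau> ?\<xi>2 ?u)" if s: "s \<in> {\<tau>..\<tau> + T}" for s
  proof -
    have fl: "flow s \<tau> (l + k *\<^sub>R ?v) ?u = l + (k - \<sigma> * (s - \<tau>)) *\<^sub>R ?v" for k
      using s by (simp add: flow_u_cst algebra_simps)
    \<comment> \<open>From the start of the window on, the motion never approaches \<open>l\<close>,
      so neither coefficient changes sign.\<close>
    have "(c - \<sigma> * (s - \<tau>)) * (c + \<epsilon> - \<sigma> * (s - \<tau>)) > 0"
    proof (cases "\<sigma> > 0")
      case True
      then have "\<sigma> * (s - \<tau>) \<ge> 0" using s by simp
      then show ?thesis using True \<epsilon> by (intro mult_neg_neg) (auto simp: c_def)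
    next
      case False
      then have "\<sigma> * (s - \<tau>) \<le> 0" using s by (simp add: mult_nonpos_nonneg)
      then show ?thesis using False \<epsilon> by (intro mult_pos_pos) (auto simp: c_def)
    qed
    then show ?thesis
      using bearing_collinear[OF assms(1), of ?v] assms(2) unfolding fl by auto
  qed
  then have "output_error h \<tau> (\<tau> + T) ?\<xi>1 ?\<xi>2 ?u = integral {\<tau>..\<tau> + T} (\<lambda>s. 0)"
    unfolding output_error_def by (intro integral_cong) simp
  moreover have "?\<xi>2 \<in> cball ?\<xi>1 R"
    using diff \<epsilon>(3) by (simp add: dist_norm)
  ultimately have "\<kappa> (\<epsilon> * norm ?v) \<le> 0"
    using ge[of ?\<xi>1 ?\<xi>2] R diff by simp
  moreover have "\<kappa> 0 < \<kappa> (\<epsilon> * norm ?v)"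
    using \<kappa> \<epsilon>(1) assms(2) unfolding K_function_def
    by (intro strict_mono_onD[of "{0..}" \<kappa>]) auto
  ultimately show False
    using \<kappa> by (simp add: K_function_def)
qed

section \<open>Decay of the Grammian along the spiral\<close>

lemma norm_matrix_le_sum:
  fixes A :: "real^'n^'m"
  shows "norm A \<le> (\<Sum>i\<in>UNIV. \<Sum>j\<in>UNIV. \<bar>A$i$j\<bar>)"
proof -
  have "norm A \<le> (\<Sum>i\<in>UNIV. norm (A$i))"
    unfolding norm_vec_def[of A] by (rule L2_set_le_sum) simp
  also have "\<dots> \<le> (\<Sum>i\<in>UNIV. \<Sum>j\<in>UNIV. \<bar>A$i$j\<bar>)"
    by (intro sum_mono norm_le_l1_cart)
  finally show ?thesis .
qed

text \<open>Passes from the Frobenius norm, which \<open>norm\<close> denotes on matrices and in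
  which the integral is estimated, to the operator norm. The crude factor does not affect a limit
  0.\<close>

lemma onorm_matrix_le:
  fixes A :: "real^'n^'m"
  shows "onorm ((*v) A) \<le> real (CARD('m)) * real (CARD('n)) * norm A"
proof (rule onorm_le_matrix_component)
  fix i :: 'm and j :: 'n
  show "\<bar>A$i$j\<bar> \<le> norm A"
    using component_le_norm_cart[of "A$i" j] Finite_Cartesian_Product.norm_nth_le[of A i] by simp
qed

lemma matrix_2_axis:
  "(vector [vector [a, b], vector [c, d]] :: real^2^2) =
    a *\<^sub>R axis 1 (axis 1 1) + b *\<^sub>R axis 1 (axis 2 1)
    + c *\<^sub>R axis 2 (axis 1 1) + d *\<^sub>R axis 2 (axis 2 1)"
  by (simp add: vec_eq_iff forall_2 axis_def)

text \<open>Each of the four entries is at most \<open>(norm e)\<^sup>2\<close> in absolute value.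
  For \<open>e = 0\<close> both sides are 0, by the convention on division.\<close>

lemma norm_grammian_integrand_le:
  fixes e :: "real^2"
  shows "norm ((1 / norm e ^ 4) *\<^sub>R (vector [vector [(e$2)\<^sup>2, - (e$1) * e$2],
      vector [- (e$1) * e$2, (e$1)\<^sup>2]] :: real^2^2)) \<le> 4 / (norm e)\<^sup>2"
proof -
  have e: "\<bar>e$i * e$j\<bar> \<le> (norm e)\<^sup>2" for i j
    unfolding abs_mult power2_eq_square by (intro mult_mono component_le_norm_cart) auto
  have "norm (vector [vector [(e$2)\<^sup>2, - (e$1) * e$2],
      vector [- (e$1) * e$2, (e$1)\<^sup>2]] :: real^2^2) \<le> 4 * (norm e)\<^sup>2"
    using e[of 1 1] e[of 1 2] e[of 2 2]
    by (intro order_trans[OF norm_matrix_le_sum]) (simp add: sum_2 power2_eq_square)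
  then have "norm ((1 / norm e ^ 4) *\<^sub>R (vector [vector [(e$2)\<^sup>2, - (e$1) * e$2],
      vector [- (e$1) * e$2, (e$1)\<^sup>2]] :: real^2^2)) \<le> (1 / norm e ^ 4) * (4 * (norm e)\<^sup>2)"
    unfolding norm_scaleR by (intro mult_mono) auto
  also have "\<dots> = 4 / (norm e)\<^sup>2"
    by (simp add: power2_eq_square power4_eq_xxxx)
  finally show ?thesis .
qed

text \<open>Since \<open>\<alpha> \<ge> 0\<close>, the distance to \<open>l\<close> is smallest at
  the start \<open>t - T\<close> of the window; the integrand bound there is multiplied by the
  window length.\<close>

lemma norm_bearing_grammian_u_spi_le:
  fixes l x0 :: "real^2"
  assumes r: "r > 0" and x0: "x0 - l = spiral \<psi> \<omega> \<alpha> r 0" and \<alpha>: "\<alpha> \<ge> 0" and T: "T > 0" "t \<ge> T"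
  shows "norm (bearing_grammian l x0 t T (u_spi \<psi> \<omega> \<alpha> r)) \<le> 4 / (r * exp (\<alpha> * (t - T)))\<^sup>2 * T"
proof -
  define p where "p = spiral \<psi> \<omega> \<alpha> r"
  define G :: "real \<Rightarrow> real^2^2" where "G s = (1 / norm (p s) ^ 4) *\<^sub>R
    vector [vector [(p s$2)\<^sup>2, - (p s$1) * p s$2], vector [- (p s$1) * p s$2, (p s$1)\<^sup>2]]" for s
  have np: "norm (p s) = r * exp (\<alpha> * s)" for s
    using r by (simp add: p_def norm_spiral)
  have fl: "flow s 0 x0 (u_spi \<psi> \<omega> \<alpha> r) - l = p s" if "s \<in> {t - T..t}" for s
    using that T x0 by (simp add: p_def flow_spiral diff_eq_eq)
  have "bearing_grammian l x0 t T (u_spi \<psi> \<omega> \<alpha> r) = integral {t - T..t} G"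
    unfolding bearing_grammian_def Let_def norm_minus_commute[of l]
    by (rule integral_cong) (simp only: fl G_def)
  moreover have "norm (integral {t - T..t} G) \<le> 4 / (r * exp (\<alpha> * (t - T)))\<^sup>2 * (t - (t - T))"
  proof (rule integral_bound)
    have "norm (p s) ^ 4 \<noteq> 0" for s
      using r by (simp add: np)
    then show "continuous_on {t - T..t} G"
      unfolding G_def matrix_2_axis p_def
      by (intro continuous_intros continuous_on_spiral) (auto simp: p_def)
    fix s assume s: "s \<in> {t - T..t}"
    have "norm (G s) \<le> 4 / (norm (p s))\<^sup>2"
      unfolding G_def by (rule norm_grammian_integrand_le)
    also have "\<dots> \<le> 4 / (r * exp (\<alpha> * (t - T)))\<^sup>2"
      unfolding np using r \<alpha> s by (intro divide_left_mono power_mono) (auto simp: mult_left_mono)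
    finally show "norm (G s) \<le> 4 / (r * exp (\<alpha> * (t - T)))\<^sup>2" .
  qed (use T in simp)
  ultimately show ?thesis by simp
qed

lemma onorm_bearing_grammian_u_spi_tendsto_0:
  fixes l x0 :: "real^2"
  assumes r: "r > 0" and x0: "x0 - l = spiral \<psi> \<omega> \<alpha> r 0" and \<alpha>: "\<alpha> > 0" and T: "T > 0"
  shows "((\<lambda>t. onorm ((*v) (bearing_grammian l x0 t T (u_spi \<psi> \<omega> \<alpha> r)))) \<longlongrightarrow> 0) at_top"
proof (rule tendsto_sandwich[OF _ _ tendsto_const])
  \<comment> \<open>The outer 4 is the dimension factor of the operator norm for 2 x 2 matrices, the
    inner 4 the number of entries.\<close>
  show "((\<lambda>t. 4 * (4 / (r * exp (\<alpha> * (t - T)))\<^sup>2 * T)) \<longlongrightarrow> 0) at_top"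
    using r \<alpha> T by real_asymp
  show "\<forall>\<^sub>F t in at_top. onorm ((*v) (bearing_grammian l x0 t T (u_spi \<psi> \<omega> \<alpha> r)))
      \<le> 4 * (4 / (r * exp (\<alpha> * (t - T)))\<^sup>2 * T)"
    using eventually_ge_at_top[of T]
  proof eventually_elim
    case (elim t)
    show ?case
      using onorm_matrix_le[of "bearing_grammian l x0 t T (u_spi \<psi> \<omega> \<alpha> r)"]
        norm_bearing_grammian_u_spi_le[OF r x0 less_imp_le[OF \<alpha>] T elim] by simp
  qed
qed (auto simp: onorm_pos_le)

theorem proposition5p1:
  fixes l x0 :: "real^2" and h :: "real^2 \<Rightarrow> real^2" and r0 \<psi>0 :: real
  assumes "x0 \<noteq> l"
    and "bearing_output l h"
    and "r0 = norm (l - x0)"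
    and "x0 - l = r0 *\<^sub>R vector [cos \<psi>0, sin \<psi>0]"
  shows "(\<forall>\<sigma>::real. \<not> universal_input h (u_cst l x0 \<sigma>) \<and> \<not> weakly_persistent h (u_cst l x0 \<sigma>) x0)
    \<and> (\<forall>\<omega>>0. weakly_regularly_persistent h (u_circ \<psi>0 \<omega> r0) x0)
    \<and> (\<forall>\<omega>>0. \<forall>\<alpha>>0. weakly_persistent h (u_spi \<psi>0 \<omega> \<alpha> r0) x0
         \<and> (\<forall>T>0. ((\<lambda>t. onorm ((*v) (bearing_grammian l x0 t T (u_spi \<psi>0 \<omega> \<alpha> r0)))) \<longlongrightarrow> 0) at_top))"
proof -
  \<comment> \<open>At time 0 the spiral depends neither on \<open>\<omega>\<close> nor on
    \<open>\<alpha>\<close>, so one fact serves the circle and all spirals.\<close>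
  have r: "r0 > 0" and x0: "x0 - l = spiral \<psi>0 \<omega> \<alpha> r0 0" for \<omega> \<alpha>
    using assms by (auto simp: spiral_def dir2_def)
  show ?thesis
    using not_universal_input_u_cst[OF assms(2,1)] not_weakly_persistent_u_cst[OF assms(2,1)]
      weakly_regularly_persistent_u_circ[OF assms(2) r x0] weakly_persistent_u_spi[OF assms(2) r x0]
      onorm_bearing_grammian_u_spi_tendsto_0[OF r x0]
    by simp
qed

end
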